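(* Let $(X,\tau,E)$ and $(Y,\tau',E)$ be soft topological spaces and let $f:(X,\tau,E)\to(Y,\tau',E)$ be a soft mapping. Then the following statements are equivalent. (i) $f$ is soft $\beta$-continuous. (ii) For each soft point $(x_e,E)$ over $X$ and each soft open set $(G,E)$ over $Y$ containing $f(x_e,E)=(f(x)_e,E)$, there exists a soft $\beta$-open set $(F,E)$ over $X$ containing $(x_e,E)$ such that $f(F,E)\,\widetilde{\subseteq}\,(G,E)$. (iii) The inverse image under $f$ of each soft closed set in $Y$ is soft $\beta$-closed in $X$. (iv) $int(cl(int(f^{-1}(G,E))))\,\widetilde{\subseteq}\,f^{-1}(cl(G,E))$ for each soft set $(G,E)$ over $Y$. (v) $f(int(cl(int(F,E))))\,\widetilde{\subseteq}\,cl(f(F,E))$ for each soft set $(F,E)$ over $X$.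
   Context: Let $X$ be a set and $E$ a non-empty set of parameters. A soft set $(F,E)$ over $X$ is a mapping $F:E\to P(X)$. Inclusion $\widetilde{\subseteq}$, union $\widetilde{\cup}$ and intersection $\widetilde{\cap}$ of soft sets are taken parameterwise (for each $e\in E$); $\Phi$ is the soft set with value $\emptyset$ at every $e$, $\widetilde{X}$ the soft set with value $X$ at every $e$. The relative complement of $(F,E)$ is the soft set $e\mapsto X\setminus F(e)$. A soft topology on $X$ is a collection $\tau$ of soft sets over $X$ containing $\Phi$ and $\widetilde{X}$ and closed under arbitrary unions and intersections of two members; $(X,\tau,E)$ is then a soft topological space. Members of $\tau$ are soft open; a soft set is soft closed if its relative complement is in $\tau$. $int(F,E)$ is the union of all soft open sets contained in $(F,E)$, and $cl(F,E)$ is the intersection of all soft closed sets containing $(F,E)$. The soft set $(F,E)$ is soft $\beta$-open if $(F,E)\,\widetilde{\subseteq}\,cl(int(cl(F,E)))$, and soft $\beta$-closed if $int(cl(int(F,E)))\,\widetilde{\subseteq}\,(F,E)$. A (soft) mapping $f:(X,\tau,E)\to(Y,\tau',E)$ is a function $f:X\to Y$, acting with the fixed parameter set $E$ by $f(F,E)(e)=f(F(e))$ and $f^{-1}(G,E)(e)=f^{-1}(G(e))$ for all $e\in E$. It is soft $\beta$-continuous if $f^{-1}(G,E)$ is soft $\beta$-open in $(X,\tau,E)$ for every soft open set $(G,E)$ of $(Y,\tau',E)$. For $x\in X$ and $e\in E$, the soft point $(x_e,E)$ is the soft set with value $\{x\}$ at $e$ and $\emptyset$ at every $e'\in E\setminus\{e\}$.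 A soft set $(F,E)$ contains $(x_e,E)$ if $(x_e,E)\,\widetilde{\subseteq}\,(F,E)$, i.e. $x\in F(e)$. *)

theory Defs
  imports "HOL-Library.FuncSet"
begin

text \<open>
  A soft set over \<open>X\<close> with parameter set \<open>E\<close> is a map \<open>E \<rightarrow> P(X)\<close>, encoded as an element of
  the extensional function space, so that equality of soft sets is equality of functions.
\<close>

definition soft_sets :: "'a set \<Rightarrow> 'e set \<Rightarrow> ('e \<Rightarrow> 'a set) set" where
  "soft_sets X E = (E \<rightarrow>\<^sub>E Pow X)"

definition soft_subset :: "'e set \<Rightarrow> ('e \<Rightarrow> 'a set) \<Rightarrow> ('e \<Rightarrow> 'a set) \<Rightarrow> bool" where
  "soft_subset E F G \<longleftrightarrow> (\<forall>e\<in>E. F e \<subseteq> G e)"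

definition soft_empty :: "'e set \<Rightarrow> 'e \<Rightarrow> 'a set" where
  "soft_empty E = (\<lambda>e\<in>E. {})"

definition soft_whole :: "'a set \<Rightarrow> 'e set \<Rightarrow> 'e \<Rightarrow> 'a set" where
  "soft_whole X E = (\<lambda>e\<in>E. X)"

definition soft_compl :: "'a set \<Rightarrow> 'e set \<Rightarrow> ('e \<Rightarrow> 'a set) \<Rightarrow> 'e \<Rightarrow> 'a set" where
  "soft_compl X E F = (\<lambda>e\<in>E. X - F e)"

definition soft_inter :: "'e set \<Rightarrow> ('e \<Rightarrow> 'a set) \<Rightarrow> ('e \<Rightarrow> 'a set) \<Rightarrow> 'e \<Rightarrow> 'a set" where
  "soft_inter E F G = (\<lambda>e\<in>E. F e \<inter> G e)"

definition soft_Union :: "'e set \<Rightarrow> ('e \<Rightarrow> 'a set) set \<Rightarrow> 'e \<Rightarrow> 'a set" where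
  "soft_Union E A = (\<lambda>e\<in>E. \<Union>F\<in>A. F e)"

text \<open>
  For an empty family the next definition yields \<open>UNIV\<close> rather than \<open>X\<close>.  In a soft topological
  space the family defining the closure of a soft set always contains the whole soft set.
\<close>

definition soft_Inter :: "'e set \<Rightarrow> ('e \<Rightarrow> 'a set) set \<Rightarrow> 'e \<Rightarrow> 'a set" where
  "soft_Inter E A = (\<lambda>e\<in>E. \<Inter>F\<in>A. F e)"

definition soft_topology :: "'a set \<Rightarrow> 'e set \<Rightarrow> ('e \<Rightarrow> 'a set) set \<Rightarrow> bool" where
  "soft_topology X E \<tau> \<longleftrightarrow>
     \<tau> \<subseteq> soft_sets X E \<and>
     soft_empty E \<in> \<tau> \<and>
     soft_whole X E \<in> \<tau> \<and>
     (\<forall>A. A \<subseteq> \<tau> \<longrightarrow> soft_Union E A \<in> \<tau>) \<and>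
     (\<forall>F\<in>\<tau>. \<forall>G\<in>\<tau>. soft_inter E F G \<in> \<tau>)"

definition soft_closed :: "'a set \<Rightarrow> 'e set \<Rightarrow> ('e \<Rightarrow> 'a set) set \<Rightarrow> ('e \<Rightarrow> 'a set) \<Rightarrow> bool" where
  "soft_closed X E \<tau> F \<longleftrightarrow> F \<in> soft_sets X E \<and> soft_compl X E F \<in> \<tau>"

definition soft_int :: "'e set \<Rightarrow> ('e \<Rightarrow> 'a set) set \<Rightarrow> ('e \<Rightarrow> 'a set) \<Rightarrow> 'e \<Rightarrow> 'a set" where
  "soft_int E \<tau> F = soft_Union E {U \<in> \<tau>. soft_subset E U F}"

definition soft_cl ::
  "'a set \<Rightarrow> 'e set \<Rightarrow> ('e \<Rightarrow> 'a set) set \<Rightarrow> ('e \<Rightarrow> 'a set) \<Rightarrow> 'e \<Rightarrow> 'a set" where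
  "soft_cl X E \<tau> F = soft_Inter E {C. soft_closed X E \<tau> C \<and> soft_subset E F C}"

definition soft_beta_open ::
  "'a set \<Rightarrow> 'e set \<Rightarrow> ('e \<Rightarrow> 'a set) set \<Rightarrow> ('e \<Rightarrow> 'a set) \<Rightarrow> bool" where
  "soft_beta_open X E \<tau> F \<longleftrightarrow>
     F \<in> soft_sets X E \<and>
     soft_subset E F (soft_cl X E \<tau> (soft_int E \<tau> (soft_cl X E \<tau> F)))"

definition soft_beta_closed ::
  "'a set \<Rightarrow> 'e set \<Rightarrow> ('e \<Rightarrow> 'a set) set \<Rightarrow> ('e \<Rightarrow> 'a set) \<Rightarrow> bool" where
  "soft_beta_closed X E \<tau> F \<longleftrightarrow>
     F \<in> soft_sets X E \<and>
     soft_subset E (soft_int E \<tau> (soft_cl X E \<tau> (soft_int E \<tau> F))) F"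

definition soft_image :: "'e set \<Rightarrow> ('a \<Rightarrow> 'b) \<Rightarrow> ('e \<Rightarrow> 'a set) \<Rightarrow> 'e \<Rightarrow> 'b set" where
  "soft_image E f F = (\<lambda>e\<in>E. f ` F e)"

definition soft_vimage ::
  "'a set \<Rightarrow> 'e set \<Rightarrow> ('a \<Rightarrow> 'b) \<Rightarrow> ('e \<Rightarrow> 'b set) \<Rightarrow> 'e \<Rightarrow> 'a set" where
  "soft_vimage X E f G = (\<lambda>e\<in>E. f -` G e \<inter> X)"

definition soft_beta_continuous ::
  "'a set \<Rightarrow> 'e set \<Rightarrow> ('e \<Rightarrow> 'a set) set \<Rightarrow> ('e \<Rightarrow> 'b set) set \<Rightarrow> ('a \<Rightarrow> 'b) \<Rightarrow> bool" where
  "soft_beta_continuous X E \<tau> \<tau>' f \<longleftrightarrow>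
     (\<forall>G\<in>\<tau>'. soft_beta_open X E \<tau> (soft_vimage X E f G))"

definition soft_point :: "'e set \<Rightarrow> 'a \<Rightarrow> 'e \<Rightarrow> 'e \<Rightarrow> 'a set" where
  "soft_point E x e = (\<lambda>e'\<in>E. if e' = e then {x} else {})"

lemma soft_image_soft_point: "soft_image E f (soft_point E x e) = soft_point E (f x) e"
  by (auto simp: soft_image_def soft_point_def fun_eq_iff)

lemma soft_subset_soft_point_iff: "e \<in> E \<Longrightarrow> soft_subset E (soft_point E x e) F \<longleftrightarrow> x \<in> F e"
  by (auto simp: soft_subset_def soft_point_def)

end

theory Submission
  imports Defs
begin

text \<open>
  Write \<open>\<alpha> F = int (cl (int F))\<close> and \<open>\<beta> F = cl (int (cl F))\<close>. Both operators are monotone, and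
  since complementation exchanges interior and closure it exchanges \<open>\<alpha>\<close> and \<open>\<beta>\<close>. Hence a soft
  set is soft \<open>\<beta>\<close>-closed exactly when its complement is soft \<open>\<beta>\<close>-open
  (\<open>soft_beta_closed_iff_beta_open_compl\<close>). As inverse images commute with complements, this gives
  the equivalence of (i) and (iii).

  The remaining equivalences need no further duality. For (ii), \<open>\<beta>\<close>-openness can be tested at
  points: if every point of \<open>f\<^sup>-\<^sup>1 G\<close> lies in some \<open>\<beta>\<close>-open \<open>F\<close> below \<open>f\<^sup>-\<^sup>1 G\<close>, then it lies in
  \<open>\<beta> F\<close> and therefore, by monotonicity, in \<open>\<beta> (f\<^sup>-\<^sup>1 G)\<close>. For (iii), (iv) and (v), the set \<open>cl G\<close> is the least closed
  set above \<open>G\<close>, so testing on closed sets is the same as testing on all \<open>G\<close> with \<open>cl G\<close> on the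
  right-hand side; and (iv) and (v) correspond to each other under the adjunction
  \<open>f F \<subseteq> G \<longleftrightarrow> F \<subseteq> f\<^sup>-\<^sup>1 G\<close>.
\<close>

section \<open>Inclusion, complements, images and inverse images\<close>

lemma soft_subset_refl: "soft_subset E F F"
  by (simp add: soft_subset_def)

lemma soft_subset_trans [trans]:
  "soft_subset E F G \<Longrightarrow> soft_subset E G H \<Longrightarrow> soft_subset E F H"
  unfolding soft_subset_def by blast

lemma soft_compl_in_soft_sets: "soft_compl X E F \<in> soft_sets X E"
  unfolding soft_compl_def soft_sets_def by auto

lemma soft_compl_compl:
  assumes "F \<in> soft_sets X E"
  shows "soft_compl X E (soft_compl X E F) = F"
proof
  fix e
  show "soft_compl X E (soft_compl X E F) e = F e"
    using PiE_mem[OF assms[unfolded soft_sets_def], of e]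
      PiE_arb[OF assms[unfolded soft_sets_def], of e]
    by (cases "e \<in> E") (auto simp: soft_compl_def)
qed

lemma soft_compl_antimono:
  "soft_subset E F G \<Longrightarrow> soft_subset E (soft_compl X E G) (soft_compl X E F)"
  unfolding soft_subset_def soft_compl_def by auto

lemma soft_subset_compl_compl_iff:
  assumes "F \<in> soft_sets X E" and "G \<in> soft_sets X E"
  shows "soft_subset E (soft_compl X E F) (soft_compl X E G) \<longleftrightarrow> soft_subset E G F"
  using soft_compl_antimono[of E G F X]
    soft_compl_antimono[of E "soft_compl X E F" "soft_compl X E G" X] assms
  by (auto simp: soft_compl_compl)

lemma soft_vimage_in_soft_sets: "soft_vimage X E f G \<in> soft_sets X E"
  unfolding soft_vimage_def soft_sets_def by auto

lemma soft_image_in_soft_sets: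
  assumes "f \<in> X \<rightarrow> Y" and "F \<in> soft_sets X E"
  shows "soft_image E f F \<in> soft_sets Y E"
  using assms unfolding soft_image_def soft_sets_def by (fastforce simp: PiE_iff)

lemma soft_vimage_compl:
  assumes "f \<in> X \<rightarrow> Y"
  shows "soft_vimage X E f (soft_compl Y E G) = soft_compl X E (soft_vimage X E f G)"
  using assms unfolding soft_vimage_def soft_compl_def by (auto simp: fun_eq_iff)

lemma soft_vimage_mono:
  "soft_subset E G H \<Longrightarrow> soft_subset E (soft_vimage X E f G) (soft_vimage X E f H)"
  unfolding soft_subset_def soft_vimage_def by auto

lemma soft_image_subset_iff_subset_vimage:
  assumes "F \<in> soft_sets X E"
  shows "soft_subset E (soft_image E f F) G \<longleftrightarrow> soft_subset E F (soft_vimage X E f G)"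
proof -
  have "F e \<subseteq> X" if "e \<in> E" for e
    using assms that unfolding soft_sets_def by auto
  then show ?thesis
    unfolding soft_subset_def soft_image_def soft_vimage_def by fastforce
qed

section \<open>Interior and closure\<close>

lemma soft_int_mono: "soft_subset E F G \<Longrightarrow> soft_subset E (soft_int E \<tau> F) (soft_int E \<tau> G)"
  unfolding soft_subset_def soft_int_def soft_Union_def by fastforce

lemma soft_cl_mono: "soft_subset E F G \<Longrightarrow> soft_subset E (soft_cl X E \<tau> F) (soft_cl X E \<tau> G)"
  unfolding soft_subset_def soft_cl_def soft_Inter_def by fastforce

lemma subset_soft_cl: "soft_subset E F (soft_cl X E \<tau> F)"
  unfolding soft_subset_def soft_cl_def soft_Inter_def by auto

lemma soft_cl_least:
  "soft_closed X E \<tau> C \<Longrightarrow> soft_subset E F C \<Longrightarrow> soft_subset E (soft_cl X E \<tau> F) C"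
  unfolding soft_subset_def soft_cl_def soft_Inter_def by auto

context
  fixes X :: "'a set" and E :: "'e set" and \<tau> :: "('e \<Rightarrow> 'a set) set"
  assumes top: "soft_topology X E \<tau>"
begin

lemma soft_open_in_soft_sets: "U \<in> \<tau> \<Longrightarrow> U \<in> soft_sets X E"
  using top by (auto simp: soft_topology_def)

lemma soft_closed_compl_open: "U \<in> \<tau> \<Longrightarrow> soft_closed X E \<tau> (soft_compl X E U)"
  unfolding soft_closed_def
  by (simp add: soft_compl_in_soft_sets soft_compl_compl soft_open_in_soft_sets)

lemma soft_int_open: "soft_int E \<tau> F \<in> \<tau>"
proof -
  have "soft_Union E A \<in> \<tau>" if "A \<subseteq> \<tau>" for A
    using top that by (simp add: soft_topology_def)
  then show ?thesis
    by (simp add: soft_int_def)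
qed

lemma soft_int_in_soft_sets: "soft_int E \<tau> F \<in> soft_sets X E"
  by (rule soft_open_in_soft_sets[OF soft_int_open])

text \<open>
  The closed sets above \<open>F\<close> are exactly the complements of the open sets below the complement
  of \<open>F\<close>, so De Morgan turns the intersection defining the closure into the union defining the
  interior.
\<close>

lemma soft_compl_cl:
  assumes F: "F \<in> soft_sets X E"
  shows "soft_compl X E (soft_cl X E \<tau> F) = soft_int E \<tau> (soft_compl X E F)"
proof
  fix e
  show "soft_compl X E (soft_cl X E \<tau> F) e = soft_int E \<tau> (soft_compl X E F) e"
  proof (cases "e \<in> E")
    case False
    then show ?thesis by (simp add: soft_compl_def soft_int_def soft_Union_def)
  next
    case e: True
    show ?thesis
    proof (intro equalityI subsetI)
      fix x assume "x \<in> soft_compl X E (soft_cl X E \<tau> F) e"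
      then obtain C where C: "soft_closed X E \<tau> C" "soft_subset E F C" and x: "x \<in> X" "x \<notin> C e"
        using e by (auto simp: soft_compl_def soft_cl_def soft_Inter_def)
      from C have "soft_compl X E C \<in> \<tau>"
        and "soft_subset E (soft_compl X E C) (soft_compl X E F)"
        by (auto simp: soft_closed_def soft_compl_antimono)
      moreover have "x \<in> soft_compl X E C e"
        using x e by (simp add: soft_compl_def)
      ultimately show "x \<in> soft_int E \<tau> (soft_compl X E F) e"
        using e by (auto simp: soft_int_def soft_Union_def)
    next
      fix x assume "x \<in> soft_int E \<tau> (soft_compl X E F) e"
      then obtain U where U: "U \<in> \<tau>" "soft_subset E U (soft_compl X E F)" and x: "x \<in> U e"
        using e by (auto simp: soft_int_def soft_Union_def)
      have "soft_subset E F (soft_compl X E U)"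
        using soft_compl_antimono[OF U(2), of X] F by (simp add: soft_compl_compl)
      then have "soft_subset E (soft_cl X E \<tau> F) (soft_compl X E U)"
        using soft_closed_compl_open[OF U(1)] by (rule soft_cl_least[rotated])
      then have "soft_cl X E \<tau> F e \<subseteq> X - U e"
        using e by (auto simp: soft_subset_def soft_compl_def)
      moreover have "x \<in> X"
        using soft_open_in_soft_sets[OF U(1)] x e by (auto simp: soft_sets_def)
      ultimately show "x \<in> soft_compl X E (soft_cl X E \<tau> F) e"
        using x e by (auto simp: soft_compl_def)
    qed
  qed
qed

lemma soft_cl_in_soft_sets:
  assumes "F \<in> soft_sets X E"
  shows "soft_cl X E \<tau> F \<in> soft_sets X E"
proof -
  \<comment> \<open>The whole soft set belongs to the family defining the closure, so the intersection stays
    inside \<open>X\<close>.\<close>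
  have "soft_compl X E (soft_empty E) = soft_whole X E"
    by (simp add: soft_compl_def soft_empty_def soft_whole_def fun_eq_iff)
  moreover have "soft_empty E \<in> \<tau>"
    using top by (simp add: soft_topology_def)
  ultimately have "soft_closed X E \<tau> (soft_whole X E)"
    using soft_closed_compl_open[of "soft_empty E"] by simp
  moreover have "soft_subset E F (soft_whole X E)"
    using assms by (auto simp: soft_subset_def soft_whole_def soft_sets_def)
  ultimately have "soft_subset E (soft_cl X E \<tau> F) (soft_whole X E)"
    by (rule soft_cl_least)
  then have "soft_cl X E \<tau> F e \<in> Pow X" if "e \<in> E" for e
    using that by (simp add: soft_subset_def soft_whole_def)
  moreover have "soft_cl X E \<tau> F e = undefined" if "e \<notin> E" for e
    using that by (simp add: soft_cl_def soft_Inter_def)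
  ultimately show ?thesis
    unfolding soft_sets_def by (rule PiE_I)
qed

lemma soft_closed_cl:
  "F \<in> soft_sets X E \<Longrightarrow> soft_closed X E \<tau> (soft_cl X E \<tau> F)"
  unfolding soft_closed_def by (simp add: soft_cl_in_soft_sets soft_compl_cl soft_int_open)

lemma soft_compl_int:
  assumes F: "F \<in> soft_sets X E"
  shows "soft_compl X E (soft_int E \<tau> F) = soft_cl X E \<tau> (soft_compl X E F)"
proof -
  let ?F' = "soft_compl X E F"
  have "soft_compl X E (soft_cl X E \<tau> ?F') = soft_int E \<tau> F"
    using F by (simp add: soft_compl_cl soft_compl_in_soft_sets soft_compl_compl)
  then show ?thesis
    using soft_compl_compl[OF soft_cl_in_soft_sets[OF soft_compl_in_soft_sets[of X E F]]] by simp
qed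

text \<open>
  The closure-interior duality turns the complement of \<open>int (cl (int F))\<close> into
  \<open>cl (int (cl (X - F)))\<close>, so complementing the inclusion that makes \<open>F\<close> \<open>\<beta>\<close>-closed yields the one
  that makes \<open>X - F\<close> \<open>\<beta>\<close>-open.
\<close>

lemma soft_beta_closed_iff_beta_open_compl:
  assumes F: "F \<in> soft_sets X E"
  shows "soft_beta_closed X E \<tau> F \<longleftrightarrow> soft_beta_open X E \<tau> (soft_compl X E F)"
proof -
  let ?A = "soft_int E \<tau> (soft_cl X E \<tau> (soft_int E \<tau> F))"
  have "soft_compl X E ?A = soft_cl X E \<tau> (soft_int E \<tau> (soft_cl X E \<tau> (soft_compl X E F)))"
    using F by (simp add: soft_compl_int soft_compl_cl soft_cl_in_soft_sets soft_int_in_soft_sets)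
  moreover have "soft_subset E (soft_compl X E F) (soft_compl X E ?A) \<longleftrightarrow> soft_subset E ?A F"
    using F by (simp add: soft_subset_compl_compl_iff soft_int_in_soft_sets)
  ultimately show ?thesis
    using F by (simp add: soft_beta_closed_def soft_beta_open_def soft_compl_in_soft_sets)
qed

text \<open>
  This amounts to saying that unions of soft \<open>\<beta>\<close>-open sets are soft \<open>\<beta>\<close>-open: each \<open>F\<close> below \<open>H\<close>
  lies in \<open>cl (int (cl F))\<close>, hence in \<open>cl (int (cl H))\<close>. The pointwise form is the one in which
  neighbourhood conditions such as (ii) supply the sets \<open>F\<close>.
\<close>

lemma soft_beta_openI_pointwise:
  assumes H: "H \<in> soft_sets X E"
    and nbhd: "\<And>e x. e \<in> E \<Longrightarrow> x \<in> H e \<Longrightarrow>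
      \<exists>F. soft_beta_open X E \<tau> F \<and> x \<in> F e \<and> soft_subset E F H"
  shows "soft_beta_open X E \<tau> H"
  unfolding soft_beta_open_def soft_subset_def
proof (intro conjI ballI subsetI H)
  fix e x assume e: "e \<in> E" and "x \<in> H e"
  then obtain F where F: "soft_beta_open X E \<tau> F" "x \<in> F e" "soft_subset E F H"
    using nbhd by blast
  have "soft_subset E F (soft_cl X E \<tau> (soft_int E \<tau> (soft_cl X E \<tau> F)))"
    using F(1) by (simp add: soft_beta_open_def)
  also have "soft_subset E \<dots> (soft_cl X E \<tau> (soft_int E \<tau> (soft_cl X E \<tau> H)))"
    by (intro soft_cl_mono soft_int_mono F(3))
  finally show "x \<in> soft_cl X E \<tau> (soft_int E \<tau> (soft_cl X E \<tau> H)) e"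
    using F(2) e unfolding soft_subset_def by blast
qed

end

section \<open>Characterizations of soft \<open>\<beta>\<close>-continuity\<close>

theorem theorem4p5:
  fixes X :: "'a set" and Y :: "'b set" and E :: "'e set"
    and \<tau> :: "('e \<Rightarrow> 'a set) set" and \<tau>' :: "('e \<Rightarrow> 'b set) set"
    and f :: "'a \<Rightarrow> 'b"
  assumes "E \<noteq> {}"
    and "soft_topology X E \<tau>"
    and "soft_topology Y E \<tau>'"
    and "f \<in> X \<rightarrow> Y"
  defines "i \<equiv> soft_beta_continuous X E \<tau> \<tau>' f"
    and "ii \<equiv> \<forall>x\<in>X. \<forall>e\<in>E. \<forall>G\<in>\<tau>'.
           soft_subset E (soft_image E f (soft_point E x e)) G \<longrightarrow>
           (\<exists>F. soft_beta_open X E \<tau> F \<and> soft_subset E (soft_point E x e) F \<and>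
                soft_subset E (soft_image E f F) G)"
    and "iii \<equiv> \<forall>G. soft_closed Y E \<tau>' G \<longrightarrow> soft_beta_closed X E \<tau> (soft_vimage X E f G)"
    and "iv \<equiv> \<forall>G\<in>soft_sets Y E.
           soft_subset E
             (soft_int E \<tau> (soft_cl X E \<tau> (soft_int E \<tau> (soft_vimage X E f G))))
             (soft_vimage X E f (soft_cl Y E \<tau>' G))"
    and "v \<equiv> \<forall>F\<in>soft_sets X E.
           soft_subset E
             (soft_image E f (soft_int E \<tau> (soft_cl X E \<tau> (soft_int E \<tau> F))))
             (soft_cl Y E \<tau>' (soft_image E f F))"
  shows "(i \<longleftrightarrow> ii) \<and> (i \<longleftrightarrow> iii) \<and> (i \<longleftrightarrow> iv) \<and> (i \<longleftrightarrow> v)"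
proof -
  note X = assms(2) and Y = assms(3) and f = assms(4)
  let ?pre = "soft_vimage X E f"
  let ?A = "\<lambda>F. soft_int E \<tau> (soft_cl X E \<tau> (soft_int E \<tau> F))"
  have A_mono: "soft_subset E (?A F) (?A G)" if "soft_subset E F G" for F G
    by (intro soft_int_mono soft_cl_mono that)
  have pre_adj: "soft_subset E (soft_image E f F) G \<longleftrightarrow> soft_subset E F (?pre G)"
    if "F \<in> soft_sets X E" for F G
    using that by (rule soft_image_subset_iff_subset_vimage)

  have "i \<longleftrightarrow> ii"
  proof
    assume i
    show ii
      unfolding ii_def
    proof (intro ballI impI)
      fix x e G
      assume x: "x \<in> X" and e: "e \<in> E" and G: "G \<in> \<tau>'"
        and sub: "soft_subset E (soft_image E f (soft_point E x e)) G"
      have point: "soft_point E x e \<in> soft_sets X E"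
        using x by (auto simp: soft_point_def soft_sets_def)
      have "soft_beta_open X E \<tau> (?pre G)"
        using \<open>i\<close> G by (simp add: i_def soft_beta_continuous_def)
      moreover have "soft_subset E (soft_point E x e) (?pre G)"
        using sub pre_adj[OF point] by simp
      moreover have "soft_subset E (soft_image E f (?pre G)) G"
        by (simp add: pre_adj soft_vimage_in_soft_sets soft_subset_refl)
      ultimately show "\<exists>F. soft_beta_open X E \<tau> F \<and> soft_subset E (soft_point E x e) F \<and>
          soft_subset E (soft_image E f F) G"
        by blast
    qed
  next
    assume ii
    show i
      unfolding i_def soft_beta_continuous_def
    proof (intro ballI soft_beta_openI_pointwise soft_vimage_in_soft_sets X)
      fix G e x
      assume G: "G \<in> \<tau>'" and e: "e \<in> E" and x: "x \<in> ?pre G e"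
      then have "x \<in> X" and "soft_subset E (soft_image E f (soft_point E x e)) G"
        by (simp_all add: soft_vimage_def soft_image_soft_point soft_subset_soft_point_iff)
      then obtain F where F: "soft_beta_open X E \<tau> F" "soft_subset E (soft_point E x e) F"
          "soft_subset E (soft_image E f F) G"
        using \<open>ii\<close> G e unfolding ii_def by blast
      moreover have "F \<in> soft_sets X E"
        using F(1) by (simp add: soft_beta_open_def)
      ultimately show "\<exists>F. soft_beta_open X E \<tau> F \<and> x \<in> F e \<and> soft_subset E F (?pre G)"
        using e by (auto simp: pre_adj soft_subset_soft_point_iff)
    qed
  qed

  moreover have "i \<longleftrightarrow> iii"
  proof
    assume i
    show iii
      unfolding iii_def
    proof (intro allI impI)
      fix G assume "soft_closed Y E \<tau>' G"
      then have "soft_beta_open X E \<tau> (?pre (soft_compl Y E G))"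
        using \<open>i\<close> by (simp add: i_def soft_beta_continuous_def soft_closed_def)
      then show "soft_beta_closed X E \<tau> (?pre G)"
        by (simp add: soft_vimage_compl[OF f] soft_beta_closed_iff_beta_open_compl[OF X]
            soft_vimage_in_soft_sets)
    qed
  next
    assume iii
    show i
      unfolding i_def soft_beta_continuous_def
    proof
      fix G assume G: "G \<in> \<tau>'"
      then have "soft_beta_closed X E \<tau> (?pre (soft_compl Y E G))"
        using \<open>iii\<close> soft_closed_compl_open[OF Y] by (simp add: iii_def)
      then show "soft_beta_open X E \<tau> (?pre G)"
        by (simp add: soft_vimage_compl[OF f] soft_beta_closed_iff_beta_open_compl[OF X]
            soft_compl_in_soft_sets soft_compl_compl soft_vimage_in_soft_sets)
    qed
  qed

  moreover have "iv" if iii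
    unfolding iv_def
  proof
    fix G assume G: "G \<in> soft_sets Y E"
    have "soft_subset E (?A (?pre G)) (?A (?pre (soft_cl Y E \<tau>' G)))"
      by (intro A_mono soft_vimage_mono subset_soft_cl)
    also have "soft_subset E \<dots> (?pre (soft_cl Y E \<tau>' G))"
      using \<open>iii\<close> soft_closed_cl[OF Y G] by (simp add: iii_def soft_beta_closed_def)
    finally show "soft_subset E (?A (?pre G)) (?pre (soft_cl Y E \<tau>' G))" .
  qed

  moreover have "v" if iv
    unfolding v_def
  proof
    fix F assume F: "F \<in> soft_sets X E"
    have "soft_subset E F (?pre (soft_image E f F))"
      using pre_adj[OF F, of "soft_image E f F"] by (simp add: soft_subset_refl)
    then have "soft_subset E (?A F) (?A (?pre (soft_image E f F)))"
      by (rule A_mono)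
    also have "soft_subset E \<dots> (?pre (soft_cl Y E \<tau>' (soft_image E f F)))"
      using \<open>iv\<close> soft_image_in_soft_sets[OF f F] by (simp add: iv_def)
    finally show "soft_subset E (soft_image E f (?A F)) (soft_cl Y E \<tau>' (soft_image E f F))"
      by (simp add: pre_adj soft_int_in_soft_sets[OF X])
  qed

  moreover have "iii" if v
    unfolding iii_def soft_beta_closed_def
  proof (intro allI impI conjI soft_vimage_in_soft_sets)
    fix G assume G: "soft_closed Y E \<tau>' G"
    have "soft_subset E (soft_image E f (?A (?pre G))) (soft_cl Y E \<tau>' (soft_image E f (?pre G)))"
      using \<open>v\<close> by (simp add: v_def soft_vimage_in_soft_sets)
    also have "soft_subset E \<dots> G"
      by (intro soft_cl_least G) (simp add: pre_adj soft_vimage_in_soft_sets soft_subset_refl)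
    finally show "soft_subset E (?A (?pre G)) (?pre G)"
      by (simp add: pre_adj soft_int_in_soft_sets[OF X])
  qed

  ultimately show ?thesis by blast
qed

end
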